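(* Let $\mathcal{H}$ be a separable complex Hilbert space and let $\mathcal{E}$ be the set of all b-Riesz bases for $\mathcal{H}$. Then the collection $\Gamma=\{[\{e_k\}] : \{e_k\}_{k=1}^\infty \text{ is an orthonormal basis for } \mathcal{H}\}$ is a partition of $\mathcal{E}$; consequently the relation $\sim$ on $\mathcal{E}$ defined by $$\{f_k\}_{k=1}^\infty\sim\{g_k\}_{k=1}^\infty \iff \text{there exists an orthonormal basis } \{e_k\}_{k=1}^\infty \text{ for } \mathcal{H} \text{ such that } \{f_k\}_{k=1}^\infty,\{g_k\}_{k=1}^\infty\in[\{e_k\}]$$ is an equivalence relation on $\mathcal{E}$.
   Context: A pair $(\{f_k\}_{k=1}^\infty,\{g_k\}_{k=1}^\infty)$ of sequences in $\mathcal{H}$ is a biframe for $\mathcal{H}$ if there exist constants $A,B>0$ such that $A\|f\|^2\le\sum_{k=1}^\infty\langle f,f_k\rangle\langle g_k,f\rangle\le B\|f\|^2$ for all $f\in\mathcal{H}$ (the series converging to a real number). For an orthonormal basis $\{e_k\}_{k=1}^\infty$, $[\{e_k\}]$ denotes the set of all sequences $\{f_k\}_{k=1}^\infty$ such that $(\{e_k\}_{k=1}^\infty,\{f_k\}_{k=1}^\infty)$ is a biframe for $\mathcal{H}$. A sequence $\{f_k\}_{k=1}^\infty$ is a b-Riesz basis for $\mathcal{H}$ if $\{f_k\}_{k=1}^\infty\in[\{e_k\}]$ for some orthonormal basis $\{e_k\}_{k=1}^\infty$ for $\mathcal{H}$. The inner product is linear in the first variable. *)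

theory Defs
  imports "HOL-Analysis.Analysis"
begin

text \<open>
  Complex inner product spaces, with the inner product linear in the first argument.
  Positive definiteness follows from \<open>cinner_self\<close> and the norm axioms.
\<close>

class complex_inner = real_normed_vector +
  fixes scaleC :: "complex \<Rightarrow> 'a \<Rightarrow> 'a"  (infixr \<open>*\<^sub>C\<close> 75)
    and cinner :: "'a \<Rightarrow> 'a \<Rightarrow> complex"
  assumes scaleC_add_right: "c *\<^sub>C (x + y) = c *\<^sub>C x + c *\<^sub>C y"
    and scaleC_add_left: "(c + d) *\<^sub>C x = c *\<^sub>C x + d *\<^sub>C x"
    and scaleC_scaleC: "c *\<^sub>C (d *\<^sub>C x) = (c * d) *\<^sub>C x"
    and scaleC_of_real: "complex_of_real r *\<^sub>C x = r *\<^sub>R x"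
    and cinner_commute: "cinner x y = cnj (cinner y x)"
    and cinner_add_left: "cinner (x + y) z = cinner x z + cinner y z"
    and cinner_scaleC_left: "cinner (c *\<^sub>C x) y = c * cinner x y"
    and cinner_self: "cinner x x = complex_of_real ((norm x)\<^sup>2)"

class complex_hilbert_space = complex_inner + complete_space

instantiation complex :: complex_hilbert_space
begin

definition scaleC_complex :: "complex \<Rightarrow> complex \<Rightarrow> complex"
  where "scaleC_complex c x = c * x"

definition cinner_complex :: "complex \<Rightarrow> complex \<Rightarrow> complex"
  where "cinner_complex x y = x * cnj y"

instance
  by standard
    (simp_all add: scaleC_complex_def cinner_complex_def complex_norm_square
      scaleR_conv_of_real algebra_simps del: of_real_power)

end

definition orthonormal_seq :: "(nat \<Rightarrow> 'a::complex_inner) \<Rightarrow> bool"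
  where "orthonormal_seq e \<longleftrightarrow> (\<forall>j k. cinner (e j) (e k) = (if j = k then 1 else 0))"

definition schauder_basis :: "(nat \<Rightarrow> 'a::complex_inner) \<Rightarrow> bool"
  where "schauder_basis e \<longleftrightarrow> (\<forall>f. \<exists>!c::nat \<Rightarrow> complex. (\<lambda>k. c k *\<^sub>C e k) sums f)"

definition orthonormal_basis :: "(nat \<Rightarrow> 'a::complex_inner) \<Rightarrow> bool"
  where "orthonormal_basis e \<longleftrightarrow> orthonormal_seq e \<and> schauder_basis e"

text \<open>The terms of the series are complex; its sum \<open>s\<close> is required to be real.\<close>

definition biframe :: "(nat \<Rightarrow> 'a::complex_inner) \<Rightarrow> (nat \<Rightarrow> 'a) \<Rightarrow> bool"
  where "biframe F G \<longleftrightarrow>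
    (\<exists>A B :: real. A > 0 \<and> B > 0 \<and>
      (\<forall>f. \<exists>s::real. (\<lambda>k. cinner f (F k) * cinner (G k) f) sums complex_of_real s \<and>
        A * (norm f)\<^sup>2 \<le> s \<and> s \<le> B * (norm f)\<^sup>2))"

definition biframe_class :: "(nat \<Rightarrow> 'a::complex_inner) \<Rightarrow> (nat \<Rightarrow> 'a) set"
  where "biframe_class e = {F. biframe e F}"

definition b_riesz_basis :: "(nat \<Rightarrow> 'a::complex_inner) \<Rightarrow> bool"
  where "b_riesz_basis F \<longleftrightarrow> (\<exists>e. orthonormal_basis e \<and> F \<in> biframe_class e)"

definition b_riesz_bases :: "(nat \<Rightarrow> 'a::complex_inner) set"
  where "b_riesz_bases = {F. b_riesz_basis F}"

definition b_riesz_rel :: "((nat \<Rightarrow> 'a::complex_inner) \<times> (nat \<Rightarrow> 'a)) set"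
  where "b_riesz_rel = {(F, G). F \<in> b_riesz_bases \<and> G \<in> b_riesz_bases \<and>
    (\<exists>e. orthonormal_basis e \<and> F \<in> biframe_class e \<and> G \<in> biframe_class e)}"

end

theory Submission
  imports Defs
begin

text \<open>
  If \<open>F\<close> lies in the class of \<open>e\<close>, then \<open>T x = \<Sum>k. \<langle>x, e k\<rangle> F k\<close> defines a bounded self-adjoint operator
  that is bounded below by a positive constant and maps \<open>e k\<close> to \<open>F k\<close>. Suppose that \<open>F\<close> also lies
  in the class of \<open>e'\<close>, with operator \<open>T'\<close>. Then \<open>\<langle>T x, e k\<rangle> = \<langle>x, F k\<rangle> = \<langle>T' x, e' k\<rangle>\<close>, so Parseval's identity
  in both bases gives \<open>T\<^sup>2 = T'\<^sup>2\<close>. Positive square roots are unique, hence \<open>T = T'\<close>, and injectivity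
  of \<open>T\<close> gives \<open>e = e'\<close>. So two classes with a common element even come from the same basis.
\<close>

section \<open>Complex inner product spaces\<close>

lemma cinner_add_right: "cinner x (y + z) = cinner x y + cinner x (z::'a::complex_inner)"
  by (metis cinner_add_left cinner_commute complex_cnj_add)

lemma cinner_scaleC_right: "cinner x (c *\<^sub>C y) = cnj c * cinner x (y::'a::complex_inner)"
  by (metis cinner_commute cinner_scaleC_left complex_cnj_mult)

lemma cinner_scaleR_left: "cinner (r *\<^sub>R x) y = of_real r * cinner x (y::'a::complex_inner)"
  by (metis cinner_scaleC_left scaleC_of_real)

lemma cinner_scaleR_right: "cinner x (r *\<^sub>R y) = of_real r * cinner x (y::'a::complex_inner)"
  by (metis cinner_scaleC_right complex_cnj_complex_of_real scaleC_of_real)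

lemma cinner_minus_left: "cinner (- x) y = - cinner x (y::'a::complex_inner)"
  using cinner_scaleR_left[of "-1" x y] by simp

lemma cinner_minus_right: "cinner x (- y) = - cinner x (y::'a::complex_inner)"
  using cinner_scaleR_right[of x "-1" y] by simp

lemma cinner_diff_left: "cinner (x - y) z = cinner x z - cinner y (z::'a::complex_inner)"
  using cinner_add_left[of x "-y" z] by (simp add: cinner_minus_left)

lemma cinner_diff_right: "cinner x (y - z) = cinner x y - cinner x (z::'a::complex_inner)"
  using cinner_add_right[of x y "-z"] by (simp add: cinner_minus_right)

lemma cinner_zero_left [simp]: "cinner 0 (x::'a::complex_inner) = 0"
  using cinner_diff_left[of x x x] by simp

lemma cinner_sum_left: "cinner (\<Sum>i\<in>I. f i) (y::'a::complex_inner) = (\<Sum>i\<in>I. cinner (f i) y)"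
  by (induction I rule: infinite_finite_induct) (simp_all add: cinner_add_left)

lemma cinner_eqI:
  assumes "\<And>z. cinner x z = cinner (y::'a::complex_inner) z"
  shows "x = y"
  using cinner_self[of "x - y"] assms[of "x - y"] by (simp add: cinner_diff_left)

lemma norm_add_sq: "(norm (x + y))\<^sup>2 = (norm x)\<^sup>2 + 2 * Re (cinner x y) + (norm (y::'a::complex_inner))\<^sup>2"
proof -
  have "Re (cinner y x) = Re (cinner x y)"
    by (subst cinner_commute) simp
  moreover have "(norm z)\<^sup>2 = Re (cinner z z)" for z :: 'a
    by (simp only: cinner_self Re_complex_of_real)
  ultimately show ?thesis
    by (simp add: cinner_add_left cinner_add_right)
qed

text \<open>Here the norm is primitive and satisfies the triangle inequality by axiom, so the real
  Cauchy-Schwarz inequality is read off by squaring it.\<close>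

lemma Re_cinner_le: "Re (cinner x y) \<le> norm x * norm (y::'a::complex_inner)"
proof -
  have "(norm (x + y))\<^sup>2 \<le> (norm x + norm y)\<^sup>2"
    by (simp add: norm_triangle_ineq power_mono)
  then show ?thesis
    by (simp add: norm_add_sq power2_sum)
qed

lemma norm_scaleC_ii: "norm (\<i> *\<^sub>C x) = norm (x::'a::complex_inner)"
proof -
  have "cinner (\<i> *\<^sub>C x) (\<i> *\<^sub>C x) = cinner x x"
    by (simp add: cinner_scaleC_left cinner_scaleC_right)
  then have "(norm (\<i> *\<^sub>C x))\<^sup>2 = (norm x)\<^sup>2"
    by (simp only: cinner_self of_real_eq_iff)
  then show ?thesis
    by simp
qed

text \<open>The real and imaginary parts are each bounded by the real inequality, the latter after
  replacing \<open>y\<close> by \<open>\<i> *\<^sub>C y\<close>. Adding the two bounds costs the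
  factor 2, harmless for continuity.\<close>

lemma norm_cinner_le: "norm (cinner x y) \<le> 2 * (norm x * norm (y::'a::complex_inner))"
proof -
  have "Im (cinner x y) = Re (cinner x (\<i> *\<^sub>C y))"
    by (simp add: cinner_scaleC_right)
  then have "\<bar>Im (cinner x y)\<bar> \<le> norm x * norm y"
    using Re_cinner_le[of x "\<i> *\<^sub>C y"] Re_cinner_le[of "-x" "\<i> *\<^sub>C y"]
    by (simp add: cinner_minus_left norm_scaleC_ii)
  moreover have "\<bar>Re (cinner x y)\<bar> \<le> norm x * norm y"
    using Re_cinner_le[of x y] Re_cinner_le[of "-x" y] by (simp add: cinner_minus_left)
  ultimately show ?thesis
    using cmod_le[of "cinner x y"] by linarith
qed

lemma bounded_linear_cinner_left: "bounded_linear (\<lambda>x. cinner x (y::'a::complex_inner))"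
proof (rule bounded_linear_intro[where K = "2 * norm y"])
  show "norm (cinner x y) \<le> norm x * (2 * norm y)" for x
    using norm_cinner_le[of x y] by (simp add: mult.commute mult.left_commute)
qed (simp_all add: cinner_add_left cinner_scaleR_left scaleR_conv_of_real)

section \<open>Orthonormal bases\<close>

text \<open>Pairing a Schauder expansion with \<open>e j\<close> termwise, by continuity of the
  inner product, isolates the coefficient \<open>c j\<close>.\<close>

lemma orthonormal_basis_expansion:
  assumes "orthonormal_basis (e :: nat \<Rightarrow> 'a::complex_inner)"
  shows "(\<lambda>k. cinner x (e k) *\<^sub>C e k) sums x"
proof -
  have on: "cinner (e j) (e k) = (if j = k then 1 else 0)" for j k
    using assms by (simp add: orthonormal_basis_def orthonormal_seq_def)
  obtain c where c: "(\<lambda>k. c k *\<^sub>C e k) sums x"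
    using assms unfolding orthonormal_basis_def schauder_basis_def by blast
  have "c j = cinner x (e j)" for j
  proof -
    have "(\<lambda>k. cinner (c k *\<^sub>C e k) (e j)) sums cinner x (e j)"
      by (rule bounded_linear.sums[OF bounded_linear_cinner_left c])
    moreover have "(\<lambda>k. cinner (c k *\<^sub>C e k) (e j)) = (\<lambda>k. if k = j then c k else 0)"
      by (auto simp: cinner_scaleC_left on)
    ultimately show ?thesis
      using sums_single[of j c] sums_unique2 by metis
  qed
  with c show ?thesis
    by simp
qed

lemma orthonormal_basis_parseval:
  assumes "orthonormal_basis (e :: nat \<Rightarrow> 'a::complex_inner)"
  shows "(\<lambda>k. cinner x (e k) * cinner (e k) y) sums cinner x y"
  using bounded_linear.sums[OF bounded_linear_cinner_left orthonormal_basis_expansion[OF assms]]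
  by (simp add: cinner_scaleC_left)

lemma orthonormal_basis_in_biframe_class:
  assumes "orthonormal_basis (e :: nat \<Rightarrow> 'a::complex_inner)"
  shows "e \<in> biframe_class e"
proof -
  have "(\<lambda>k. cinner f (e k) * cinner (e k) f) sums complex_of_real ((norm f)\<^sup>2)" for f
    using orthonormal_basis_parseval[OF assms, of f f] by (simp only: cinner_self)
  then have "\<exists>s. (\<lambda>k. cinner f (e k) * cinner (e k) f) sums complex_of_real s \<and>
      1 * (norm f)\<^sup>2 \<le> s \<and> s \<le> 1 * (norm f)\<^sup>2" for f
    by (metis mult_1 order_refl)
  then show ?thesis
    unfolding biframe_class_def biframe_def mem_Collect_eq using zero_less_one by blast
qed

section \<open>The operator of a biframe\<close>

text \<open>The definition gives convergence only on the diagonal. Polarization at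
  \<open>f + g\<close> and \<open>f + \<i> *\<^sub>C g\<close> writes each off-diagonal term as a
  fixed combination of diagonal terms.\<close>

lemma biframe_sesquilinear_summable:
  fixes e F :: "nat \<Rightarrow> 'a::complex_inner"
  assumes "biframe e F"
  shows "summable (\<lambda>k. cinner f (e k) * cinner (F k) g)"
proof -
  define t where "t = (\<lambda>f g k. cinner f (e k) * cinner (F k) (g::'a))"
  have diag: "summable (t h h)" for h
    using assms unfolding biframe_def t_def summable_def by meson
  have "summable (\<lambda>k. t (f + g) (f + g) k - t f f k - t g g k)"
    by (intro summable_diff diag)
  moreover have "summable (\<lambda>k. \<i> * (t (f + \<i> *\<^sub>C g) (f + \<i> *\<^sub>C g) k - t f f k - t g g k))"
    by (intro summable_mult summable_diff diag)
  ultimately have "summable (\<lambda>k. ((t (f + g) (f + g) k - t f f k - t g g k) +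
      \<i> * (t (f + \<i> *\<^sub>C g) (f + \<i> *\<^sub>C g) k - t f f k - t g g k)) / 2)"
    by (intro summable_divide summable_add)
  moreover have "((t (f + g) (f + g) k - t f f k - t g g k) +
      \<i> * (t (f + \<i> *\<^sub>C g) (f + \<i> *\<^sub>C g) k - t f f k - t g g k)) / 2 = t f g k" for k
    by (simp add: t_def cinner_add_left cinner_add_right cinner_scaleC_left cinner_scaleC_right
        algebra_simps)
  ultimately have "summable (t f g)"
    by (simp only:)
  then show ?thesis
    by (simp only: t_def)
qed

text \<open>Realness at \<open>x + y\<close> compares the imaginary parts of \<open>a x y\<close>
  and \<open>a y x\<close>; realness at \<open>x + \<i> *\<^sub>C y\<close> compares the real
  parts.\<close>

lemma hermitian_form_if_real_diagonal:
  fixes a :: "'a::complex_inner \<Rightarrow> 'a \<Rightarrow> complex"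
  assumes "\<And>x y z. a (x + y) z = a x z + a y z"
    and "\<And>x y z. a x (y + z) = a x y + a x z"
    and "\<And>c x y. a (c *\<^sub>C x) y = c * a x y"
    and "\<And>c x y. a x (c *\<^sub>C y) = cnj c * a x y"
    and real: "\<And>x. Im (a x x) = 0"
  shows "a y x = cnj (a x y)"
proof (rule complex_eqI)
  show "Re (a y x) = Re (cnj (a x y))"
    using real[of "x + \<i> *\<^sub>C y"] real[of x] real[of y] by (simp add: assms(1-4))
  show "Im (a y x) = Im (cnj (a x y))"
    using real[of "x + y"] real[of x] real[of y] by (simp add: assms(1-4))
qed

text \<open>The biframe series defines a Hermitian form \<open>a\<close>, and \<open>T\<close> is
  the operator representing it. Norm convergence of the series for \<open>T x\<close> is not given
  in advance: it comes from completeness and a bound on representing vectors.\<close>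

lemma biframe_operator:
  fixes e F :: "nat \<Rightarrow> 'a::complex_hilbert_space"
  assumes e: "orthonormal_basis e" and bf: "biframe e F"
  obtains T A where "bounded_linear T" "A > 0" "\<And>k. T (e k) = F k"
    "\<And>x y. cinner (T x) y = cinner x (T y)" "\<And>x. A * (norm x)\<^sup>2 \<le> Re (cinner (T x) x)"
proof -
  define t where "t = (\<lambda>f g k. cinner f (e k) * cinner (F k) (g::'a))"
  define a where "a = (\<lambda>f g. suminf (t f g))"
  have on: "cinner (e j) (e k) = (if j = k then 1 else 0)" for j k
    using e by (simp add: orthonormal_basis_def orthonormal_seq_def)
  have t_sums: "t f g sums a f g" for f g
    unfolding a_def t_def by (intro summable_sums biframe_sesquilinear_summable bf)
  have a_addl: "a (x + y) z = a x z + a y z" for x y z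
    using sums_add[OF t_sums[of x z] t_sums[of y z]] t_sums[of "x + y" z]
    by (intro sums_unique2) (auto simp: t_def cinner_add_left algebra_simps)
  have a_addr: "a x (y + z) = a x y + a x z" for x y z
    using sums_add[OF t_sums[of x y] t_sums[of x z]] t_sums[of x "y + z"]
    by (intro sums_unique2) (auto simp: t_def cinner_add_right algebra_simps)
  have a_scalel: "a (c *\<^sub>C x) y = c * a x y" for c x y
    using sums_mult[OF t_sums[of x y], of c] t_sums[of "c *\<^sub>C x" y]
    by (intro sums_unique2) (auto simp: t_def cinner_scaleC_left algebra_simps)
  have a_scaler: "a x (c *\<^sub>C y) = cnj c * a x y" for c x y
    using sums_mult[OF t_sums[of x y], of "cnj c"] t_sums[of x "c *\<^sub>C y"]
    by (intro sums_unique2) (auto simp: t_def cinner_scaleC_right algebra_simps)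
  obtain A B where A: "A > 0" and B: "B > 0" and
    AB: "\<And>f. \<exists>s. t f f sums complex_of_real s \<and> A * (norm f)\<^sup>2 \<le> s \<and> s \<le> B * (norm f)\<^sup>2"
    using bf unfolding biframe_def t_def by metis
  have diag: "Im (a f f) = 0 \<and> A * (norm f)\<^sup>2 \<le> Re (a f f) \<and> Re (a f f) \<le> B * (norm f)\<^sup>2" for f
    using AB[of f] t_sums[of f f] sums_unique2 by fastforce
  have herm: "a y x = cnj (a x y)" for x y
    using hermitian_form_if_real_diagonal[of a y x] a_addl a_addr a_scalel a_scaler diag by metis
  have a_minusr: "a x (- y) = - a x y" and a_minusl: "a (- x) y = - a x y" for x y
    using a_scaler[of x "-1" y] a_scalel[of "-1" x y] scaleC_of_real[of "-1" x] scaleC_of_real[of "-1" y]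
    by simp_all
  \<comment> \<open>The form at \<open>x - y\<close> is nonnegative, so dropping it from the
    polarization identity leaves a bound by \<open>B\<close> alone.\<close>
  have polar: "4 * Re (a x y) \<le> B * (norm x + norm y)\<^sup>2" for x y
  proof -
    have "0 \<le> A * (norm (x + - y))\<^sup>2"
      using A by simp
    then have "0 \<le> Re (a (x + - y) (x + - y))"
      using diag[of "x + - y"] by linarith
    moreover have "Re (a (x + y) (x + y)) - Re (a (x + - y) (x + - y)) = 4 * Re (a x y)"
      using herm[of x y] by (simp add: a_addl a_addr a_minusl a_minusr del: add_uminus_conv_diff)
    moreover have "Re (a (x + y) (x + y)) \<le> B * (norm (x + y))\<^sup>2"
      using diag by blast
    moreover have "B * (norm (x + y))\<^sup>2 \<le> B * (norm x + norm y)\<^sup>2"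
      using B by (simp add: norm_triangle_ineq power_mono)
    ultimately show ?thesis
      by linarith
  qed
  have repr_bound: "norm s \<le> B * norm x" if s: "\<And>g. cinner s g = a x g" for s x
  proof (cases "s = 0 \<or> x = 0")
    case True
    have "a 0 s = 0"
      using a_addl[of 0 0 s] by simp
    with True B show ?thesis
      using cinner_self[of s] s[of s] by auto
  next
    case False
    \<comment> \<open>Scaling \<open>s\<close> to the length of \<open>x\<close> turns the right
      side of \<open>polar\<close> into \<open>4 * B * (norm x)\<^sup>2\<close>.\<close>
    define r where "r = norm x / norm s"
    have "a x (r *\<^sub>R s) = of_real (r * (norm s)\<^sup>2)"
      using s[of "r *\<^sub>R s"] by (simp only: cinner_scaleR_right cinner_self of_real_mult)
    then have "Re (a x (r *\<^sub>R s)) = r * (norm s)\<^sup>2"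
      by (simp only: Re_complex_of_real)
    also have "\<dots> = norm x * norm s"
      using False by (simp add: r_def power2_eq_square)
    finally have "4 * (norm x * norm s) \<le> B * (norm x + norm (r *\<^sub>R s))\<^sup>2"
      using polar[of x "r *\<^sub>R s"] by simp
    also have "norm (r *\<^sub>R s) = norm x"
      using False by (simp add: r_def)
    finally have "norm x * norm s \<le> norm x * (B * norm x)"
      by (simp add: power2_eq_square algebra_simps)
    then show ?thesis
      using False by (simp add: mult_le_cancel_left)
  qed
  have "\<exists>s. \<forall>g. cinner s g = a x g" for x
  proof -
    define P where "P = (\<lambda>n. \<Sum>k<n. cinner x (e k) *\<^sub>C e k)"
    define S where "S = (\<lambda>n. \<Sum>k<n. cinner x (e k) *\<^sub>C F k)"
    have S_P: "cinner (S n) g = a (P n) g" for n g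
    \<comment> \<open>The coefficients of \<open>P n\<close> vanish from index \<open>n\<close> on,
      so the series for \<open>a (P n) g\<close> is a finite sum.\<close>
    proof -
      have P_e: "cinner (P n) (e k) = (if k < n then cinner x (e k) else 0)" for k
        by (simp add: P_def cinner_sum_left cinner_scaleC_left on if_distrib[of "\<lambda>u. _ * u"] sum.delta'
            cong: if_cong)
      have "t (P n) g sums (\<Sum>k<n. t (P n) g k)"
        by (rule sums_finite) (auto simp: t_def P_e)
      then have "a (P n) g = (\<Sum>k<n. t (P n) g k)"
        using t_sums sums_unique2 by blast
      also have "\<dots> = cinner (S n) g"
        by (auto simp: t_def P_e S_def cinner_sum_left cinner_scaleC_left)
      finally show ?thesis ..
    qed
    have "cinner (S m - S n) g = a (P m - P n) g" for m n g
      using a_addl[of "P m - P n" "P n" g] by (simp add: cinner_diff_left S_P)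
    \<comment> \<open>Differences of partial sums are representing vectors too, so the Cauchy
      property passes from \<open>P\<close> to \<open>S\<close>.\<close>
    then have S_bound: "norm (S m - S n) \<le> B * norm (P m - P n)" for m n
      by (rule repr_bound)
    have "Cauchy P"
      using orthonormal_basis_expansion[OF e, of x] unfolding sums_def P_def
      by (intro LIMSEQ_imp_Cauchy)
    have "Cauchy S"
    proof (rule CauchyI)
      fix \<epsilon> :: real
      assume "\<epsilon> > 0"
      then have "\<epsilon> / B > 0"
        using B by simp
      then obtain M where M: "\<And>m n. m \<ge> M \<Longrightarrow> n \<ge> M \<Longrightarrow> norm (P m - P n) < \<epsilon> / B"
        using CauchyD[OF \<open>Cauchy P\<close>] by blast
      have "norm (S m - S n) < \<epsilon>" if "m \<ge> M" "n \<ge> M" for m n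
        using M[OF that] S_bound[of m n] B by (simp add: field_simps)
      then show "\<exists>M. \<forall>m\<ge>M. \<forall>n\<ge>M. norm (S m - S n) < \<epsilon>"
        by blast
    qed
    then obtain s where "S \<longlonglongrightarrow> s"
      using Cauchy_convergent_iff convergent_def by blast
    then have s: "(\<lambda>k. cinner x (e k) *\<^sub>C F k) sums s"
      by (simp add: sums_def S_def)
    have "cinner s g = a x g" for g
      using bounded_linear.sums[OF bounded_linear_cinner_left s, of g] t_sums[of x g]
      by (simp add: t_def cinner_scaleC_left sums_unique2)
    then show ?thesis
      by blast
  qed
  then obtain T where T: "\<And>x g. cinner (T x) g = a x g"
    by metis
  show thesis
  proof
    show "bounded_linear T"
    proof (rule bounded_linear_intro[where K = B])
      show "T (x + y) = T x + T y" for x y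
        by (rule cinner_eqI) (simp add: T cinner_add_left a_addl)
      show "T (r *\<^sub>R x) = r *\<^sub>R T x" for r x
        by (rule cinner_eqI) (simp add: T cinner_scaleC_left a_scalel flip: scaleC_of_real)
      show "norm (T x) \<le> norm x * B" for x
        using repr_bound[OF T] by (simp add: mult.commute)
    qed
    show "T (e k) = F k" for k
    proof (rule cinner_eqI)
      fix z
      have "t (e k) z = (\<lambda>j. if j = k then cinner (F j) z else 0)"
        by (auto simp: t_def on)
      then show "cinner (T (e k)) z = cinner (F k) z"
        using t_sums[of "e k" z] sums_single[of k "\<lambda>j. cinner (F j) z"] by (simp add: T sums_unique2)
    qed
    show "cinner (T x) y = cinner x (T y)" for x y
      by (metis T cinner_commute herm)
    show "A * (norm x)\<^sup>2 \<le> Re (cinner (T x) x)" for x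
      using diag T by simp
  qed (fact A)
qed

section \<open>Uniqueness of the basis\<close>

text \<open>
  With \<open>D = S - T\<close>, the hypothesis \<open>S\<^sup>2 = T\<^sup>2\<close> gives \<open>(1 + c T) D = D (1 - c S)\<close> for every \<open>c\<close>. For small
  \<open>c > 0\<close> the operator \<open>1 - c S\<close> is a contraction whereas \<open>1 + c T\<close> does not decrease norms, so \<open>D = 0\<close>.
\<close>

lemma positive_square_root_unique:
  fixes S T :: "'a::complex_inner \<Rightarrow> 'a"
  assumes S: "bounded_linear S" and T: "bounded_linear T"
    and "A > 0" and S_pos: "\<And>x. A * (norm x)\<^sup>2 \<le> Re (cinner (S x) x)"
    and T_pos: "\<And>x. 0 \<le> Re (cinner (T x) x)"
    and sq: "\<And>x. S (S x) = T (T x)"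
  shows "S = T"
proof -
  interpret S: bounded_linear S by (fact S)
  interpret T: bounded_linear T by (fact T)
  define D where "D = (\<lambda>x. S x - T x)"
  have D: "bounded_linear D"
    unfolding D_def by (intro bounded_linear_sub S T)
  interpret D: bounded_linear D by (fact D)
  obtain M where M: "M > 0" "\<And>x. norm (S x) \<le> norm x * M"
    using S.pos_bounded by blast
  \<comment> \<open>This \<open>c\<close> minimizes
    \<open>1 - 2 * c * A + c\<^sup>2 * M\<^sup>2\<close>, and \<open>q\<close> is the
    minimum.\<close>
  define c where "c = A / M\<^sup>2"
  define q where "q = 1 - A\<^sup>2 / M\<^sup>2"
  have c: "c > 0"
    using \<open>A > 0\<close> M by (simp add: c_def)
  have contr: "(norm (x - c *\<^sub>R S x))\<^sup>2 \<le> q * (norm x)\<^sup>2" for x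
  proof -
    have "Re (cinner x (S x)) = Re (cinner (S x) x)"
      by (subst cinner_commute) simp
    then have "(norm (x - c *\<^sub>R S x))\<^sup>2 = (norm x)\<^sup>2 - 2 * c * Re (cinner (S x) x) + c\<^sup>2 * (norm (S x))\<^sup>2"
      using norm_add_sq[of x "- (c *\<^sub>R S x)"]
      by (simp add: cinner_minus_right cinner_scaleR_right power_mult_distrib)
    also have "\<dots> \<le> (norm x)\<^sup>2 - 2 * c * (A * (norm x)\<^sup>2) + c\<^sup>2 * (norm x * M)\<^sup>2"
      using c S_pos[of x] M(2)[of x] by (intro add_mono diff_mono mult_left_mono power_mono) auto
    also have "\<dots> = q * (norm x)\<^sup>2"
      using M(1) by (simp add: c_def q_def field_simps power2_eq_square)
    finally show ?thesis .
  qed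
  have "D x = 0" for x
  proof (rule ccontr)
    assume "D x \<noteq> 0"
    then have pos: "onorm D > 0"
      using onorm_pos_lt[OF D] by blast
    have "x \<noteq> 0"
      using \<open>D x \<noteq> 0\<close> D.zero by blast
    then have "0 < (norm x)\<^sup>2"
      by simp
    \<comment> \<open>The nonzero vector \<open>x\<close> forces \<open>q\<close> to be nonnegative,
      so \<open>sqrt q\<close> is a genuine contraction factor.\<close>
    have "0 \<le> q * (norm x)\<^sup>2"
      using contr[of x] zero_le_power2 order_trans by blast
    then have "q \<ge> 0"
      using \<open>0 < (norm x)\<^sup>2\<close> by (simp add: zero_le_mult_iff)
    have "sqrt q < 1"
      using \<open>A > 0\<close> M by (simp add: q_def)
    \<comment> \<open>This bound makes \<open>onorm D\<close> at most \<open>sqrt q\<close> times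
      itself, which is impossible for a positive number.\<close>
    have "norm (D y) \<le> (onorm D * sqrt q) * norm y" for y
    proof -
      have "(norm (D y))\<^sup>2 \<le> (norm (D y + c *\<^sub>R T (D y)))\<^sup>2"
      proof -
        have "Re (cinner (D y) (T (D y))) = Re (cinner (T (D y)) (D y))"
          by (subst cinner_commute) simp
        then have "0 \<le> 2 * (c * Re (cinner (D y) (T (D y))))"
          using c T_pos[of "D y"] by simp
        then show ?thesis
          by (simp add: norm_add_sq cinner_scaleR_right)
      qed
      then have "norm (D y) \<le> norm (D y + c *\<^sub>R T (D y))"
        by (rule power2_le_imp_le) simp
      \<comment> \<open>Once \<open>D\<close> is expanded, the two sides differ only in
        \<open>T (T y)\<close> against \<open>S (S y)\<close>, which agree by
        \<open>sq\<close>.\<close>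
      also have "D y + c *\<^sub>R T (D y) = D (y - c *\<^sub>R S y)"
        by (simp add: D.diff D.scaleR) (simp add: D_def sq T.diff algebra_simps)
      also have "norm \<dots> \<le> onorm D * norm (y - c *\<^sub>R S y)"
        by (rule onorm[OF D])
      also have "norm (y - c *\<^sub>R S y) \<le> sqrt q * norm y"
        using real_sqrt_le_mono[OF contr[of y]] by (simp add: real_sqrt_mult)
      finally show ?thesis
        using pos by (simp add: mult.assoc)
    qed
    then have "onorm D \<le> onorm D * sqrt q"
      using pos \<open>q \<ge> 0\<close> by (intro onorm_bound) auto
    with pos \<open>sqrt q < 1\<close> show False
      by (simp add: mult_le_cancel_left1)
  qed
  then show ?thesis
    by (auto simp: D_def)
qed

lemma biframe_orthonormal_basis_unique:
  fixes e e' F :: "nat \<Rightarrow> 'a::complex_hilbert_space"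
  assumes e: "orthonormal_basis e" "biframe e F" and e': "orthonormal_basis e'" "biframe e' F"
  shows "e = e'"
proof -
  obtain T A where T: "bounded_linear T" "A > 0" "\<And>k. T (e k) = F k"
    "\<And>x y. cinner (T x) y = cinner x (T y)" "\<And>x. A * (norm x)\<^sup>2 \<le> Re (cinner (T x) x)"
    using biframe_operator[OF e] by blast
  obtain T' A' where T': "bounded_linear T'" "A' > 0" "\<And>k. T' (e' k) = F k"
    "\<And>x y. cinner (T' x) y = cinner x (T' y)" "\<And>x. A' * (norm x)\<^sup>2 \<le> Re (cinner (T' x) x)"
    using biframe_operator[OF e'] by blast
  have coeff: "cinner (T x) (e k) = cinner (T' x) (e' k)" for x k
    by (simp add: T(3,4) T'(3,4))
  then have coeff': "cinner (e k) (T x) = cinner (e' k) (T' x)" for x k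
    by (metis cinner_commute)
  have "cinner (T x) (T y) = cinner (T' x) (T' y)" for x y
    using orthonormal_basis_parseval[OF e(1), of "T x" "T y"]
      orthonormal_basis_parseval[OF e'(1), of "T' x" "T' y"]
    by (simp add: coeff coeff' sums_unique2)
  \<comment> \<open>Self-adjointness moves the outer operator across, turning equal Gram forms into
    equal squares.\<close>
  then have "cinner (T (T x)) y = cinner (T' (T' x)) y" for x y
    by (simp add: T(4) T'(4))
  then have "T (T x) = T' (T' x)" for x
    using cinner_eqI by blast
  moreover have "0 \<le> Re (cinner (T' x) x)" for x
    using T'(2) T'(5)[of x] by (meson less_imp_le mult_nonneg_nonneg order_trans zero_le_power2)
  ultimately have "T = T'"
    using positive_square_root_unique[OF T(1) T'(1) T(2) T(5)] by blast
  show ?thesis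
  proof
    fix k
    \<comment> \<open>Both basis vectors are sent to \<open>F k\<close>, and the lower bound on
      \<open>T\<close> makes its kernel trivial.\<close>
    have "T (e k - e' k) = 0"
      using T(3) T'(3) \<open>T = T'\<close> linear_diff[OF bounded_linear.linear[OF T(1)]] by simp
    then show "e k = e' k"
      using T(5)[of "e k - e' k"] T(2) by (simp add: mult_le_0_iff)
  qed
qed

theorem mainTheorem15:
  assumes "separable_space (euclidean :: 'a::complex_hilbert_space topology)"
  shows "partition_on (b_riesz_bases :: (nat \<Rightarrow> 'a) set) {biframe_class e | e. orthonormal_basis e}
    \<and> equiv (b_riesz_bases :: (nat \<Rightarrow> 'a) set) b_riesz_rel"
proof
  have unique: "e = e'" if "orthonormal_basis e" "orthonormal_basis e'"
    "F \<in> biframe_class e" "F \<in> biframe_class e'" for e e' F :: "nat \<Rightarrow> 'a"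
    using that biframe_orthonormal_basis_unique unfolding biframe_class_def by blast
  show "partition_on (b_riesz_bases :: (nat \<Rightarrow> 'a) set) {biframe_class e | e. orthonormal_basis e}"
  proof (rule partition_onI)
    show "\<Union> {biframe_class e | e. orthonormal_basis e} = (b_riesz_bases :: (nat \<Rightarrow> 'a) set)"
      by (auto simp: b_riesz_bases_def b_riesz_basis_def)
    \<comment> \<open>Each class contains its own basis, by Parseval with both bounds equal to
      1.\<close>
    show "{} \<notin> {biframe_class e | e :: nat \<Rightarrow> 'a. orthonormal_basis e}"
      using orthonormal_basis_in_biframe_class by fastforce
    show "disjnt p q" if "p \<in> {biframe_class e | e :: nat \<Rightarrow> 'a. orthonormal_basis e}"
      "q \<in> {biframe_class e | e :: nat \<Rightarrow> 'a. orthonormal_basis e}" "p \<noteq> q" for p q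
      using that unique unfolding disjnt_iff by blast
  qed
  show "equiv (b_riesz_bases :: (nat \<Rightarrow> 'a) set) b_riesz_rel"
  proof (rule equivI)
    show "refl_on (b_riesz_bases :: (nat \<Rightarrow> 'a) set) b_riesz_rel"
      by (auto simp: refl_on_def b_riesz_rel_def b_riesz_bases_def b_riesz_basis_def)
    show "sym (b_riesz_rel :: ((nat \<Rightarrow> 'a) \<times> (nat \<Rightarrow> 'a)) set)"
      by (auto simp: sym_def b_riesz_rel_def)
    \<comment> \<open>The bases witnessing the two relations share the middle sequence, hence
      coincide.\<close>
    show "trans (b_riesz_rel :: ((nat \<Rightarrow> 'a) \<times> (nat \<Rightarrow> 'a)) set)"
      unfolding trans_def b_riesz_rel_def using unique by blast
  qed (auto simp: b_riesz_rel_def)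
qed

end
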